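(* Let $G=(V,E)$ be a locally finite and connected graph satisfying $CDE'(n,K)$, with $n>0$ and $K\in\mathbb R$. Let $T>0$ and let $W:[0,T]\to[0,\infty)$ be a smooth function such that $W(0)=1$, $W(T)=0$ and $W'(t)\le -K\,W(t)$ for $0\le t\le T$. Then for any bounded and positive function $f:V\to\mathbb R$, at every vertex of $G$, $$\frac{\Gamma(\sqrt{P_Tf})}{P_Tf}\le\frac12\Big(1-2K\int_0^TW(s)^2\,ds\Big)\frac{\Delta P_Tf}{P_Tf}+\frac n2\Big(\int_0^TW'(s)^2\,ds+K^2\int_0^TW(s)^2\,ds-K\Big).$$
   Context: $G=(V,E)$ is a finite or infinite connected graph with symmetric edge weights $\omega:V\times V\to[0,\infty)$, $\omega_{xy}=\omega_{yx}$, where $x\sim y$ iff $\omega_{xy}>0$; loops are allowed. Standing assumptions: $\omega_{\min}=\inf\{\omega_{xy}:\omega_{xy}>0\}>0$; $m(x):=\sum_{y\sim x}\omega_{xy}<\infty$ for all $x$; $\mu:V\to(0,\infty)$ is a measure with $D_\mu:=\sup_{x}m(x)/\mu(x)<\infty$. The Laplacian is $\Delta f(x)=\frac1{\mu(x)}\sum_{y\sim x}\omega_{xy}(f(y)-f(x))$. $2\Gamma(f,g)=\Delta(fg)-f\Delta g-g\Delta f$, $\Gamma(f)=\Gamma(f,f)$; $2\Gamma_2(f,g)=\Delta\Gamma(f,g)-\Gamma(f,\Delta g)-\Gamma(\Delta f,g)$, $\Gamma_2(f)=\Gamma_2(f,f)$; for $f>0$, $\widetilde\Gamma_2(f)=\Gamma_2(f)-\Gamma\left(f,\frac{\Gamma(f)}f\right)$.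 $G$ satisfies $CDE'(n,K)$ if for every $f:V\to(0,\infty)$ and every $x\in V$, $\widetilde\Gamma_2(f)(x)\ge\frac1n f(x)^2(\Delta\log f)(x)^2+K\,\Gamma(f)(x)$. Heat semigroup: $p(t,x,y)$ is the heat kernel of $G$ (the limit of the Dirichlet heat kernels along an exhaustion of $V$ by finite sets), and for bounded $f$, $P_tf(x)=\sum_{y\in V}\mu(y)p(t,x,y)f(y)=e^{t\Delta}f(x)=\sum_{k\ge0}\frac{t^k\Delta^kf(x)}{k!}$ (the definitions coincide since $D_\mu<\infty$ makes $\Delta$ bounded). *)

theory Defs
  imports "HOL-Analysis.Analysis"
begin

text \<open>
  A weighted graph has the type \<open>'v\<close> as its vertex set; \<open>x\<close> and \<open>y\<close> are adjacent iff
  \<open>w x y > 0\<close>, loops included. The sums over neighbours below are genuine sums only for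
  locally finite graphs, the only ones considered.
\<close>

definition nbrs :: "('v \<Rightarrow> 'v \<Rightarrow> real) \<Rightarrow> 'v \<Rightarrow> 'v set" where
  "nbrs w x = {y. w x y > 0}"

definition vdeg :: "('v \<Rightarrow> 'v \<Rightarrow> real) \<Rightarrow> 'v \<Rightarrow> real" where
  "vdeg w x = (\<Sum>y\<in>nbrs w x. w x y)"

text \<open>
  \<open>weights_bounded_below\<close> says that the infimum of the positive edge weights is positive
  (with \<open>inf {} = \<infinity>\<close> for a single vertex without loop), \<open>degree_bounded\<close> that
  \<open>D\<^sub>\<mu> = sup (m(x) / \<mu>(x))\<close> is finite. Finiteness of \<open>m(x)\<close> is part of \<open>locally_finite\<close>.
\<close>

locale weighted_graph =
  fixes w :: "'v \<Rightarrow> 'v \<Rightarrow> real" and \<mu> :: "'v \<Rightarrow> real"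
  assumes weight_nonneg: "0 \<le> w x y"
    and weight_sym: "w x y = w y x"
    and locally_finite: "finite (nbrs w x)"
    and connected_graph: "(x, y) \<in> {(a, b). w a b > 0}\<^sup>*"
    and weights_bounded_below: "\<exists>c>0. \<forall>x y. w x y > 0 \<longrightarrow> c \<le> w x y"
    and measure_pos: "0 < \<mu> x"
    and degree_bounded: "bdd_above (range (\<lambda>x. vdeg w x / \<mu> x))"

definition laplacian ::
  "('v \<Rightarrow> 'v \<Rightarrow> real) \<Rightarrow> ('v \<Rightarrow> real) \<Rightarrow> ('v \<Rightarrow> real) \<Rightarrow> 'v \<Rightarrow> real" where
  "laplacian w \<mu> f x = (1 / \<mu> x) * (\<Sum>y\<in>nbrs w x. w x y * (f y - f x))"

definition Gamma_form ::
  "('v \<Rightarrow> 'v \<Rightarrow> real) \<Rightarrow> ('v \<Rightarrow> real) \<Rightarrow> ('v \<Rightarrow> real) \<Rightarrow> ('v \<Rightarrow> real) \<Rightarrow> 'v \<Rightarrow> real" where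
  "Gamma_form w \<mu> f g x =
     (1 / 2) * (laplacian w \<mu> (\<lambda>y. f y * g y) x - f x * laplacian w \<mu> g x - g x * laplacian w \<mu> f x)"

definition Gamma2_form ::
  "('v \<Rightarrow> 'v \<Rightarrow> real) \<Rightarrow> ('v \<Rightarrow> real) \<Rightarrow> ('v \<Rightarrow> real) \<Rightarrow> ('v \<Rightarrow> real) \<Rightarrow> 'v \<Rightarrow> real" where
  "Gamma2_form w \<mu> f g x =
     (1 / 2) * (laplacian w \<mu> (Gamma_form w \<mu> f g) x
       - Gamma_form w \<mu> f (laplacian w \<mu> g) x - Gamma_form w \<mu> (laplacian w \<mu> f) g x)"

definition Gamma2_tilde ::
  "('v \<Rightarrow> 'v \<Rightarrow> real) \<Rightarrow> ('v \<Rightarrow> real) \<Rightarrow> ('v \<Rightarrow> real) \<Rightarrow> 'v \<Rightarrow> real" where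
  "Gamma2_tilde w \<mu> f x =
     Gamma2_form w \<mu> f f x - Gamma_form w \<mu> f (\<lambda>y. Gamma_form w \<mu> f f y / f y) x"

definition CDE' :: "('v \<Rightarrow> 'v \<Rightarrow> real) \<Rightarrow> ('v \<Rightarrow> real) \<Rightarrow> real \<Rightarrow> real \<Rightarrow> bool" where
  "CDE' w \<mu> n K \<longleftrightarrow>
     (\<forall>f. (\<forall>x. f x > 0) \<longrightarrow>
       (\<forall>x. Gamma2_tilde w \<mu> f x \<ge>
          (1 / n) * (f x)\<^sup>2 * (laplacian w \<mu> (\<lambda>y. ln (f y)) x)\<^sup>2 + K * Gamma_form w \<mu> f f x))"

text \<open>
  The Dirichlet Laplacian on a finite set \<open>U\<close> acts on functions on \<open>U\<close>, extended by 0 outside.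
  Its heat kernel is \<open>e\<^bsup>t\<Delta>\<^esup> \<delta>\<^sub>y(x)\<close> for \<open>\<delta>\<^sub>y = 1\<^bsub>{y}\<^esub> / \<mu>(y)\<close>,
  with \<open>\<Delta>\<close> this Dirichlet Laplacian.
\<close>

definition dirichlet_laplacian ::
  "('v \<Rightarrow> 'v \<Rightarrow> real) \<Rightarrow> ('v \<Rightarrow> real) \<Rightarrow> 'v set \<Rightarrow> ('v \<Rightarrow> real) \<Rightarrow> 'v \<Rightarrow> real" where
  "dirichlet_laplacian w \<mu> U f x =
     (if x \<in> U then laplacian w \<mu> (\<lambda>y. if y \<in> U then f y else 0) x else 0)"

definition dirichlet_heat_kernel ::
  "('v \<Rightarrow> 'v \<Rightarrow> real) \<Rightarrow> ('v \<Rightarrow> real) \<Rightarrow> 'v set \<Rightarrow> real \<Rightarrow> 'v \<Rightarrow> 'v \<Rightarrow> real" where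
  "dirichlet_heat_kernel w \<mu> U t x y =
     (if x \<in> U \<and> y \<in> U
      then \<Sum>k. t ^ k / fact k *
             (dirichlet_laplacian w \<mu> U ^^ k) (\<lambda>z. if z = y then 1 / \<mu> y else 0) x
      else 0)"

text \<open>
  The limit along all finite vertex sets directed by inclusion: every exhaustion of the graph by
  finite sets tends to this filter, so the limit does not depend on the choice of an exhaustion.
\<close>

definition heat_kernel ::
  "('v \<Rightarrow> 'v \<Rightarrow> real) \<Rightarrow> ('v \<Rightarrow> real) \<Rightarrow> real \<Rightarrow> 'v \<Rightarrow> 'v \<Rightarrow> real" where
  "heat_kernel w \<mu> t x y =
     Lim (finite_subsets_at_top UNIV) (\<lambda>U. dirichlet_heat_kernel w \<mu> U t x y)"

definition heat_semigroup ::
  "('v \<Rightarrow> 'v \<Rightarrow> real) \<Rightarrow> ('v \<Rightarrow> real) \<Rightarrow> real \<Rightarrow> ('v \<Rightarrow> real) \<Rightarrow> 'v \<Rightarrow> real" where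
  "heat_semigroup w \<mu> t f x = (\<Sum>\<^sub>\<infinity>y. \<mu> y * heat_kernel w \<mu> t x y * f y)"

text \<open>
  Smoothness on a closed interval (derivatives of all orders, one-sided at the end points);
  \<open>D k\<close> is the derivative of order \<open>k\<close>. Meaningful for \<open>a < b\<close>.
\<close>

definition smooth_on_interval :: "real \<Rightarrow> real \<Rightarrow> (real \<Rightarrow> real) \<Rightarrow> bool" where
  "smooth_on_interval a b F \<longleftrightarrow>
     (\<exists>D :: nat \<Rightarrow> real \<Rightarrow> real.
        (\<forall>t\<in>{a..b}. D 0 t = F t) \<and>
        (\<forall>k. \<forall>t\<in>{a..b}. (D k has_real_derivative D (Suc k) t) (at t within {a..b})))"

end

theory Submission
  imports Defs
begin

text \<open>
  Put \<open>u\<^sub>s = \<surd>(P\<^bsub>T-s\<^esub> f)\<close> and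
  \<open>\<phi>(s) = P\<^sub>s(\<Gamma>(u\<^sub>s))\<close>. Since \<open>\<partial>\<^sub>s u = - \<Delta>(u\<^sup>2) / (2u)\<close>,
  one finds \<open>\<phi>' = 2 P\<^sub>s(\<Gamma>\<^sub>2~(u\<^sub>s))\<close>. By \<open>CDE'\<close>, by
  \<open>u\<^sup>2 \<Delta> log u \<le> u \<Delta>u = \<Delta>(u\<^sup>2) / 2 - \<Gamma>(u)\<close> and by completing a square,
  \<open>(W\<^sup>2 \<phi>)' \<ge> W d \<Delta>P\<^sub>T f - (n/2) d\<^sup>2 P\<^sub>T f\<close> with \<open>d = W' + K W \<le> 0\<close>.
  Integrating over \<open>[0,T]\<close> gives the claim. The argument is applied to \<open>f + e\<close>, which keeps
  the square root and its time derivative bounded on an infinite graph, and then \<open>e \<rightarrow> 0\<close>.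
\<close>

section \<open>Exponentials of operators with finite rows\<close>

text \<open>The power series of \<open>e^(tL)\<close> is taken pointwise, so that no normed space of
  bounded functions has to be set up. Its convergence is shown for functions with a uniform
  bound.\<close>

definition op_exp :: "(('v \<Rightarrow> real) \<Rightarrow> 'v \<Rightarrow> real) \<Rightarrow> real \<Rightarrow> ('v \<Rightarrow> real) \<Rightarrow> 'v \<Rightarrow> real" where
  "op_exp L t f x = (\<Sum>k. t ^ k / fact k * (L ^^ k) f x)"

text \<open>An infinite matrix with finite rows and absolute row sums at most \<open>C\<close>: it
  acts on all functions and has norm at most \<open>C\<close> on bounded ones. The Laplacian and its
  shifts by multiples of the identity are of this kind.\<close>

locale finite_row_operator =
  fixes L :: "('v \<Rightarrow> real) \<Rightarrow> 'v \<Rightarrow> real" and N :: "'v \<Rightarrow> 'v set" and a :: "'v \<Rightarrow> 'v \<Rightarrow> real"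
    and C :: real
  assumes L_eq: "L f x = (\<Sum>y\<in>N x. a x y * f y)"
    and finite_row: "finite (N x)"
    and row_bound: "(\<Sum>y\<in>N x. \<bar>a x y\<bar>) \<le> C"
begin

section \<open>Powers of the operator\<close>

lemma pow_add: "(L ^^ k) (\<lambda>y. f y + g y) x = (L ^^ k) f x + (L ^^ k) g x"
  by (induction k arbitrary: x) (simp_all add: L_eq sum.distrib algebra_simps)

lemma pow_mult: "(L ^^ k) (\<lambda>y. c * f y) x = c * (L ^^ k) f x"
  by (induction k arbitrary: x) (simp_all add: L_eq sum_distrib_left algebra_simps)

lemma pow_zero: "(L ^^ k) (\<lambda>y. 0) x = 0"
  by (induction k arbitrary: x) (simp_all add: L_eq)

lemma pow_sum: "(L ^^ k) (\<lambda>y. \<Sum>i\<in>I. f i y) x = (\<Sum>i\<in>I. (L ^^ k) (f i) x)"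
  by (induction I rule: infinite_finite_induct) (simp_all add: pow_zero pow_add)

lemma L_abs_le:
  assumes "\<And>y. \<bar>f y\<bar> \<le> M"
  shows "\<bar>L f x\<bar> \<le> C * M"
proof -
  have M: "0 \<le> M" using assms[of x] by linarith
  have "\<bar>L f x\<bar> \<le> (\<Sum>y\<in>N x. \<bar>a x y\<bar> * \<bar>f y\<bar>)"
    unfolding L_eq by (rule order_trans[OF sum_abs]) (simp add: abs_mult)
  also have "\<dots> \<le> (\<Sum>y\<in>N x. \<bar>a x y\<bar> * M)"
    by (intro sum_mono mult_left_mono assms) auto
  also have "\<dots> \<le> C * M"
    unfolding sum_distrib_right[symmetric] by (intro mult_right_mono row_bound M)
  finally show ?thesis .
qed

lemma pow_abs_le:
  assumes "\<And>y. \<bar>f y\<bar> \<le> M"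
  shows "\<bar>(L ^^ k) f x\<bar> \<le> C ^ k * M"
proof (induction k arbitrary: x)
  case (Suc k)
  show ?case using L_abs_le[of "(L ^^ k) f" "C ^ k * M" x] Suc by (simp add: mult_ac)
qed (use assms in simp)

text \<open>Each application of \<open>L\<close> reads finitely many values, so \<open>k\<close>
  applications still do. Hence truncations of \<open>f\<close> to large finite sets can replace
  \<open>f\<close> in any single term of the series.\<close>

lemma pow_finite_dependence:
  "\<exists>F. finite F \<and> (\<forall>f g. (\<forall>y\<in>F. f y = g y) \<longrightarrow> (L ^^ k) f x = (L ^^ k) g x)"
proof (induction k arbitrary: x)
  case 0
  show ?case by (rule exI[of _ "{x}"]) simp
next
  case (Suc k)
  then obtain F where F: "\<And>x. finite (F x)"
    "\<And>x f g. (\<forall>y\<in>F x. f y = g y) \<Longrightarrow> (L ^^ k) f x = (L ^^ k) g x"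
    by metis
  show ?case
  proof (intro exI[of _ "\<Union>y\<in>N x. F y"] conjI allI impI)
    fix f g :: "'v \<Rightarrow> real" assume "\<forall>y\<in>\<Union>y\<in>N x. F y. f y = g y"
    then have "(L ^^ k) f y = (L ^^ k) g y" if "y \<in> N x" for y
      using that by (intro F(2)) auto
    then show "(L ^^ Suc k) f x = (L ^^ Suc k) g x"
      by (simp add: L_eq)
  qed (use F finite_row in auto)
qed

section \<open>Convergence and linearity of the exponential series\<close>

lemma exp_bound_summable: "summable (\<lambda>k. \<bar>t\<bar> ^ k / fact k * (C ^ k * M))"
proof -
  have "summable (\<lambda>k. M * ((\<bar>t\<bar> * C) ^ k /\<^sub>R fact k))"
    by (intro summable_mult summable_exp_generic)
  then show ?thesis by (simp add: power_mult_distrib divide_inverse mult_ac)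
qed

lemma exp_term_le:
  assumes "\<And>y. \<bar>f y\<bar> \<le> M" and "\<bar>t\<bar> \<le> R"
  shows "\<bar>t ^ k / fact k * (L ^^ k) f x\<bar> \<le> R ^ k / fact k * (C ^ k * M)"
proof -
  have "\<bar>t ^ k / fact k\<bar> \<le> R ^ k / fact k"
    using assms(2) by (simp add: power_abs divide_right_mono power_mono)
  with pow_abs_le[OF assms(1)] show ?thesis
    unfolding abs_mult using assms(2) by (intro mult_mono) auto
qed

lemma op_exp_sums:
  assumes "\<And>y. \<bar>f y\<bar> \<le> M"
  shows "(\<lambda>k. t ^ k / fact k * (L ^^ k) f x) sums op_exp L t f x"
  unfolding op_exp_def
  by (rule summable_sums, rule summable_comparison_test[OF _ exp_bound_summable[of t M]])
     (use exp_term_le[OF assms, of t "\<bar>t\<bar>"] in auto)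

lemma op_exp_abs_le:
  assumes "\<And>y. \<bar>f y\<bar> \<le> M" and "\<bar>t\<bar> \<le> R"
  shows "\<bar>op_exp L t f x\<bar> \<le> exp (R * C) * M"
proof -
  have R: "0 \<le> R" using assms(2) by linarith
  have "(\<lambda>k. M * ((R * C) ^ k /\<^sub>R fact k)) sums (M * exp (R * C))"
    by (intro sums_mult exp_converges)
  then have "(\<lambda>k. R ^ k / fact k * (C ^ k * M)) sums (exp (R * C) * M)"
    by (simp add: power_mult_distrib divide_inverse mult_ac)
  then have s: "summable (\<lambda>k. R ^ k / fact k * (C ^ k * M))"
      "(\<Sum>k. R ^ k / fact k * (C ^ k * M)) = exp (R * C) * M"
    by (simp_all add: sums_iff)
  have "norm (\<Sum>k. t ^ k / fact k * (L ^^ k) f x) \<le> (\<Sum>k. R ^ k / fact k * (C ^ k * M))"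
    by (rule norm_suminf_le[OF _ s(1)]) (unfold real_norm_def, rule exp_term_le[OF assms])
  then show ?thesis
    unfolding s(2) op_exp_def by simp
qed

lemma op_exp_0 [simp]: "op_exp L 0 f = f"
proof
  fix x
  have "(\<lambda>k. 0 ^ k / fact k * (L ^^ k) f x) sums ((L ^^ 0) f x)"
    using powser_sums_zero[of "\<lambda>k. (L ^^ k) f x / fact k"] by (simp add: mult_ac)
  then show "op_exp L 0 f x = f x"
    unfolding op_exp_def by (simp add: sums_iff)
qed

lemma op_exp_add:
  assumes "\<And>y. \<bar>f y\<bar> \<le> M" and "\<And>y. \<bar>g y\<bar> \<le> M'"
  shows "op_exp L t (\<lambda>y. f y + g y) x = op_exp L t f x + op_exp L t g x"
proof -
  have "t ^ k / fact k * (L ^^ k) (\<lambda>y. f y + g y) x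
      = t ^ k / fact k * (L ^^ k) f x + t ^ k / fact k * (L ^^ k) g x" for k
    unfolding pow_add by (rule distrib_left)
  then show ?thesis
    unfolding op_exp_def[of L t "\<lambda>y. f y + g y"]
    by (simp only: sums_unique[OF sums_add[OF op_exp_sums[OF assms(1)] op_exp_sums[OF assms(2)]], symmetric])
qed

lemma op_exp_mult:
  assumes "\<And>y. \<bar>f y\<bar> \<le> M"
  shows "op_exp L t (\<lambda>y. c * f y) x = c * op_exp L t f x"
proof -
  have "t ^ k / fact k * (L ^^ k) (\<lambda>y. c * f y) x = c * (t ^ k / fact k * (L ^^ k) f x)" for k
    unfolding pow_mult by (rule mult.left_commute)
  then show ?thesis
    unfolding op_exp_def[of L t "\<lambda>y. c * f y"]
    by (simp only: sums_unique[OF sums_mult[OF op_exp_sums[OF assms]], symmetric])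
qed

lemma op_exp_sum:
  assumes "\<And>i y. i \<in> I \<Longrightarrow> \<bar>f i y\<bar> \<le> M i"
  shows "op_exp L t (\<lambda>y. \<Sum>i\<in>I. f i y) x = (\<Sum>i\<in>I. op_exp L t (f i) x)"
proof -
  have "(\<lambda>k. \<Sum>i\<in>I. t ^ k / fact k * (L ^^ k) (f i) x) sums (\<Sum>i\<in>I. op_exp L t (f i) x)"
    by (rule sums_sum, rule op_exp_sums, erule assms)
  then show ?thesis
    unfolding op_exp_def[of L t "\<lambda>y. \<Sum>i\<in>I. f i y"]
    by (simp add: pow_sum sum_distrib_left sums_iff)
qed

text \<open>Each row of \<open>L\<close> is a finite sum, so \<open>L\<close> may be applied to the
  series term by term.\<close>

lemma op_exp_commute:
  assumes "\<And>y. \<bar>f y\<bar> \<le> M"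
  shows "op_exp L t (L f) x = L (op_exp L t f) x"
proof -
  have "(\<lambda>k. \<Sum>y\<in>N x. a x y * (t ^ k / fact k * (L ^^ k) f y)) sums L (op_exp L t f) x"
    unfolding L_eq[of "op_exp L t f"] by (rule sums_sum, rule sums_mult, rule op_exp_sums[OF assms])
  moreover have "(\<Sum>y\<in>N x. a x y * (t ^ k / fact k * (L ^^ k) f y))
      = t ^ k / fact k * (L ^^ k) (L f) x" for k
    by (simp add: funpow_swap1[symmetric] L_eq sum_distrib_left mult_ac)
  ultimately show ?thesis
    unfolding op_exp_def[of L t "L f"] by (simp add: sums_iff)
qed

section \<open>Differentiation in time\<close>

lemma pow_has_derivative:
  assumes "\<And>y. ((\<lambda>s. g s y) has_real_derivative g' y) (at t within S)"
  shows "((\<lambda>s. (L ^^ k) (g s) x) has_real_derivative (L ^^ k) g' x) (at t within S)"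
proof (induction k arbitrary: x)
  case (Suc k)
  have *: "(L ^^ Suc k) f x = (\<Sum>y\<in>N x. a x y * (L ^^ k) f y)" for f
    by (simp add: L_eq[of "(L ^^ k) f"])
  show ?case
    unfolding * by (intro DERIV_sum DERIV_cmult Suc)
qed (use assms in simp)

text \<open>The product rule for \<open>e\<^bsup>sL\<^esup> g\<^sub>s\<close>; all semigroup identities below
  come from differentiating such an expression and finding the derivative to be zero.\<close>

lemma op_exp_has_derivative:
  fixes g g' :: "real \<Rightarrow> 'v \<Rightarrow> real"
  assumes t: "t \<in> {b..c}"
    and deriv: "\<And>s y. s \<in> {b..c} \<Longrightarrow> ((\<lambda>s. g s y) has_real_derivative g' s y) (at s within {b..c})"
    and M: "\<And>s y. s \<in> {b..c} \<Longrightarrow> \<bar>g s y\<bar> \<le> M"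
    and M': "\<And>s y. s \<in> {b..c} \<Longrightarrow> \<bar>g' s y\<bar> \<le> M'"
  shows "((\<lambda>s. op_exp L s (g s) x) has_real_derivative
            op_exp L t (\<lambda>y. L (g t) y + g' t y) x) (at t within {b..c})"
proof -
  define R where "R = max \<bar>b\<bar> \<bar>c\<bar>"
  have R: "\<bar>s\<bar> \<le> R" "0 \<le> R" if "s \<in> {b..c}" for s
    using that unfolding R_def by auto
  define h where "h k s = s ^ k / fact k * (L ^^ k) (g s) x" for k s
  define h' where "h' k s = real k * s ^ (k - 1) / fact k * (L ^^ k) (g s) x
      + s ^ k / fact k * (L ^^ k) (g' s) x" for k s
  \<comment> \<open>Majorant of the differentiated terms on the whole interval, for the Weierstrass
    test.\<close>
  define B where "B k = real k * R ^ (k - 1) / fact k * (C ^ k * M)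
      + R ^ k / fact k * (C ^ k * M')" for k
  have h_deriv: "(h k has_real_derivative h' k s) (at s within {b..c})" if "s \<in> {b..c}" for k s
  proof -
    have "((\<lambda>s. s ^ k / fact k) has_real_derivative real k * s ^ (k - 1) / fact k) (at s within {b..c})"
      by (auto intro!: derivative_eq_intros simp: field_simps)
    from DERIV_mult[OF this pow_has_derivative[of g "g' s" s "{b..c}" k x, OF deriv[OF that]]]
    show ?thesis unfolding h_def[abs_def] h'_def by (simp add: mult_ac)
  qed
  \<comment> \<open>An index shift turns the differentiated coefficients into the original ones; the
    term of index \<open>0\<close> vanishes because of the factor \<open>k\<close>.\<close>
  have shift: "real (Suc k) * s ^ (Suc k - 1) / fact (Suc k) = s ^ k / fact k" for s :: real and k
    by (simp del: of_nat_Suc)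
  have "summable (\<lambda>k. C * (\<bar>R\<bar> ^ k / fact k * (C ^ k * M)))"
    by (intro summable_mult exp_bound_summable)
  then have "summable (\<lambda>k. real (Suc k) * R ^ (Suc k - 1) / fact (Suc k) * (C ^ Suc k * M))"
    unfolding shift using R(2)[OF t] by (simp add: mult_ac)
  then have "summable (\<lambda>k. real k * R ^ (k - 1) / fact k * (C ^ k * M))"
    by (subst (asm) summable_Suc_iff[where f="\<lambda>k. real k * R ^ (k - 1) / fact k * (C ^ k * M)"])
  then have B_summable: "summable B"
    unfolding B_def[abs_def] using exp_bound_summable[of R M'] R(2)[OF t]
    by (intro summable_add) auto
  have h'_le: "norm (h' k s) \<le> B k" if s: "s \<in> {b..c}" for k s
  proof -
    have "\<bar>real k * s ^ (k - 1) / fact k\<bar> \<le> real k * R ^ (k - 1) / fact k"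
      using R[OF s] by (auto simp: abs_mult power_abs intro!: divide_right_mono mult_left_mono power_mono)
    then have 1: "\<bar>real k * s ^ (k - 1) / fact k * (L ^^ k) (g s) x\<bar>
        \<le> real k * R ^ (k - 1) / fact k * (C ^ k * M)"
      unfolding abs_mult[of "real k * s ^ (k - 1) / fact k"]
      using pow_abs_le[OF M[OF s], where k=k and x=x] R(2)[OF s] by (intro mult_mono) auto
    have 2: "\<bar>s ^ k / fact k * (L ^^ k) (g' s) x\<bar> \<le> R ^ k / fact k * (C ^ k * M')"
      by (rule exp_term_le[OF M'[OF s] R(1)[OF s]])
    show ?thesis
      unfolding h'_def B_def using 1 2 by (simp only: real_norm_def)
  qed
  have unif: "uniform_limit {b..c} (\<lambda>n s. \<Sum>i<n. h' i s) (\<lambda>s. \<Sum>i. h' i s) sequentially"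
    by (rule Weierstrass_m_test[OF h'_le B_summable])
  have "(\<lambda>k. h k t) sums op_exp L t (g t) x"
    unfolding h_def by (rule op_exp_sums[OF M[OF t]])
  \<comment> \<open>Termwise differentiation provides an anonymous limit function \<open>G\<close>,
    which is identified with the exponential afterwards.\<close>
  then obtain G where G: "\<And>s. s \<in> {b..c} \<Longrightarrow> (\<lambda>k. h k s) sums G s"
      "\<And>s. s \<in> {b..c} \<Longrightarrow> (G has_real_derivative (\<Sum>i. h' i s)) (at s within {b..c})"
    using has_field_derivative_series[OF _ h_deriv unif t] by (auto simp: sums_iff)
  have G_eq: "G s = op_exp L s (g s) x" if "s \<in> {b..c}" for s
    using G(1)[OF that] unfolding h_def op_exp_def by (simp add: sums_iff)
  have "(\<lambda>k. t ^ k / fact k * (L ^^ k) (L (g t)) x) sums op_exp L t (L (g t)) x"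
    by (rule op_exp_sums[where M="C * M"]) (rule L_abs_le[OF M[OF t]])
  then have "(\<lambda>k. real (Suc k) * t ^ (Suc k - 1) / fact (Suc k) * (L ^^ Suc k) (g t) x)
      sums op_exp L t (L (g t)) x"
    unfolding shift by (simp add: funpow_swap1)
  then have "(\<lambda>k. real k * t ^ (k - 1) / fact k * (L ^^ k) (g t) x) sums op_exp L t (L (g t)) x"
    by (subst (asm) sums_Suc_iff) simp
  moreover have "(\<lambda>k. t ^ k / fact k * (L ^^ k) (g' t) x) sums op_exp L t (g' t) x"
    by (rule op_exp_sums[OF M'[OF t]])
  ultimately have "(\<lambda>k. h' k t) sums (op_exp L t (L (g t)) x + op_exp L t (g' t) x)"
    unfolding h'_def by (rule sums_add)
  also have "op_exp L t (L (g t)) x + op_exp L t (g' t) x = op_exp L t (\<lambda>y. L (g t) y + g' t y) x"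
    by (rule op_exp_add[OF L_abs_le[OF M[OF t]] M'[OF t], symmetric])
  finally have "(G has_real_derivative op_exp L t (\<lambda>y. L (g t) y + g' t y) x) (at t within {b..c})"
    using G(2)[OF t] by (simp add: sums_iff)
  then show ?thesis
    by (rule has_field_derivative_transform_within[OF _ zero_less_one t]) (rule G_eq)
qed

lemma op_exp_has_derivative_const:
  assumes f: "\<And>y. \<bar>f y\<bar> \<le> M" and t: "t \<in> {b..c}"
  shows "((\<lambda>s. op_exp L s f x) has_real_derivative L (op_exp L t f) x) (at t within {b..c})"
proof -
  have "((\<lambda>s. op_exp L s f x) has_real_derivative op_exp L t (\<lambda>y. L f y + 0) x) (at t within {b..c})"
    by (rule op_exp_has_derivative[OF t, of "\<lambda>s. f" "\<lambda>s y. 0" M 0 x]) (use f in auto)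
  then show ?thesis
    unfolding add_0_right op_exp_commute[OF f] .
qed

section \<open>Approximation and superposition\<close>

text \<open>Tannery's theorem: every coefficient is eventually exact along \<open>F\<close>, and all
  are dominated by one summable majorant. It serves both for truncations of the function and for
  Dirichlet truncations of the operator.\<close>

lemma op_exp_tendsto:
  assumes "F \<noteq> bot" and f: "\<And>y. \<bar>f y\<bar> \<le> M"
    and eq: "\<And>k. \<forall>\<^sub>F U in F. p U k = (L ^^ k) f x"
    and bound: "\<And>U k. \<bar>p U k\<bar> \<le> C ^ k * M"
  shows "((\<lambda>U. \<Sum>k. t ^ k / fact k * p U k) \<longlongrightarrow> op_exp L t f x) F"
proof -
  have "((\<lambda>U. t ^ k / fact k * p U k) \<longlongrightarrow> t ^ k / fact k * (L ^^ k) f x) F" for k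
    by (intro tendsto_mult tendsto_const tendsto_eventually eq)
  moreover have "norm (t ^ k / fact k * p U k) \<le> \<bar>t\<bar> ^ k / fact k * (C ^ k * M)" for U k
    using bound[of U k] by (simp add: abs_mult power_abs divide_right_mono mult_left_mono)
  ultimately show ?thesis
    unfolding op_exp_def
    using tannerys_theorem[of "\<lambda>k U. t ^ k / fact k * p U k" "\<lambda>k. t ^ k / fact k * (L ^^ k) f x" F
        "\<lambda>k. \<bar>t\<bar> ^ k / fact k * (C ^ k * M)"] exp_bound_summable[of t M] \<open>F \<noteq> bot\<close>
    by (simp add: always_eventually)
qed

text \<open>Truncations of \<open>f\<close> to finite sets are finite combinations of indicators,
  and by finite dependence every term of their series is eventually that of \<open>f\<close>. The
  unconditional sum is the form in which the heat semigroup is defined.\<close>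

lemma op_exp_has_sum:
  assumes f: "\<And>y. \<bar>f y\<bar> \<le> M"
  shows "((\<lambda>y. f y * op_exp L t (\<lambda>z. if z = y then 1 else 0) x) has_sum op_exp L t f x) UNIV"
proof -
  let ?r = "\<lambda>B y. if y \<in> B then f y else 0"
  have M: "0 \<le> M" using f[of x] by linarith
  have r_le: "\<bar>?r B y\<bar> \<le> M" for B y
    using f[of y] M by auto
  have "((\<lambda>B. \<Sum>k. t ^ k / fact k * (L ^^ k) (?r B) x) \<longlongrightarrow> op_exp L t f x)
      (finite_subsets_at_top UNIV)"
  proof (rule op_exp_tendsto[OF _ f])
    fix k
    obtain F where F: "finite F" "\<And>g g'. (\<forall>y\<in>F. g y = g' y) \<Longrightarrow> (L ^^ k) g x = (L ^^ k) g' x"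
      using pow_finite_dependence by blast
    show "\<forall>\<^sub>F B in finite_subsets_at_top UNIV. (L ^^ k) (?r B) x = (L ^^ k) f x"
      unfolding eventually_finite_subsets_at_top
      by (intro exI[of _ F] conjI allI impI F) auto
  qed (use pow_abs_le[OF r_le] in auto)
  moreover have "(\<Sum>k. t ^ k / fact k * (L ^^ k) (?r B) x)
      = (\<Sum>y\<in>B. f y * op_exp L t (\<lambda>z. if z = y then 1 else 0) x)" if "finite B" for B
  proof -
    have "?r B = (\<lambda>z. \<Sum>y\<in>B. f y * (if z = y then 1 else 0))"
      using that by (auto simp: if_distrib cong: if_cong)
    then have "op_exp L t (?r B) x = (\<Sum>y\<in>B. op_exp L t (\<lambda>z. f y * (if z = y then 1 else 0)) x)"
      using op_exp_sum[of B "\<lambda>y z. f y * (if z = y then 1 else 0)" "\<lambda>y. M" t x] f M by auto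
    also have "\<dots> = (\<Sum>y\<in>B. f y * op_exp L t (\<lambda>z. if z = y then 1 else 0) x)"
      by (intro sum.cong refl op_exp_mult[where M=1]) simp
    finally show ?thesis unfolding op_exp_def .
  qed
  ultimately show ?thesis
    unfolding has_sum_def
    by (elim Lim_transform_eventually)
       auto
qed

section \<open>Backward evolution and the semigroup law\<close>

lemma op_exp_flip_has_derivative:
  assumes f: "\<And>y. \<bar>f y\<bar> \<le> M"
  shows "((\<lambda>s. op_exp L (T - s) f x) has_real_derivative - L (op_exp L (T - s) f) x) (at s within S)"
proof -
  \<comment> \<open>The interval around \<open>T - s\<close> gives a two-sided derivative, so that
    the chain rule applies for arbitrary \<open>S\<close>.\<close>
  have "((\<lambda>r. op_exp L r f x) has_real_derivative L (op_exp L (T - s) f) x) (at (T - s))"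
    using op_exp_has_derivative_const[OF f, where t="T - s" and b="T - s - 1" and c="T - s + 1" and x=x]
    by (simp add: at_within_interior[of "T - s" "{T - s - 1..T - s + 1}"])
  moreover have "((\<lambda>s. T - s) has_real_derivative - 1) (at s within S)"
    by (auto intro!: derivative_eq_intros)
  ultimately have "((\<lambda>s. op_exp L (T - s) f x) has_real_derivative
      L (op_exp L (T - s) f) x * - 1) (at s within S)"
    by (rule DERIV_chain2)
  then show ?thesis by simp
qed

lemma op_exp_lincomb:
  assumes "\<And>y. \<bar>f y\<bar> \<le> M" and "\<And>y. \<bar>g y\<bar> \<le> M'"
  shows "op_exp L t (\<lambda>y. c * f y + d * g y) x = c * op_exp L t f x + d * op_exp L t g x"
proof -
  have "\<bar>c * f y\<bar> \<le> \<bar>c\<bar> * M" "\<bar>d * g y\<bar> \<le> \<bar>d\<bar> * M'" for y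
    using assms[of y] by (auto simp: abs_mult intro!: mult_left_mono)
  then have "op_exp L t (\<lambda>y. c * f y + d * g y) x
      = op_exp L t (\<lambda>y. c * f y) x + op_exp L t (\<lambda>y. d * g y) x"
    by (rule op_exp_add)
  then show ?thesis
    unfolding op_exp_mult[OF assms(1)] op_exp_mult[OF assms(2)] .
qed

text \<open>The left-hand side is constant in \<open>s\<close>: its derivative vanishes because
  \<open>L - L' + c\<close> is zero, and at \<open>s = 0\<close> it equals the right-hand side. With
  \<open>c = 0\<close> this is the semigroup law; with \<open>s = T\<close> it compares the
  exponentials of \<open>L\<close> and \<open>L + c\<close>.\<close>

lemma op_exp_shift:
  assumes "finite_row_operator L' N' a' C'"
    and shift: "\<And>f x. L' f x = L f x + c * f x"
    and f: "\<And>y. \<bar>f y\<bar> \<le> M" and s: "s \<in> {0..T}"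
  shows "exp (c * s) * op_exp L s (op_exp L' (T - s) f) x = op_exp L' T f x"
proof -
  interpret L': finite_row_operator L' N' a' C' by fact
  let ?g = "\<lambda>s. op_exp L' (T - s) f"
  let ?h = "\<lambda>s. exp (c * s) * op_exp L s (?g s) x"
  have g_le: "\<bar>?g r y\<bar> \<le> exp (T * C') * M" if "r \<in> {0..T}" for r y
    by (rule L'.op_exp_abs_le[OF f]) (use that in auto)
  have "(?h has_real_derivative 0) (at r within {0..T})" if r: "r \<in> {0..T}" for r
  proof -
    have "\<bar>- L' (?g q) y\<bar> \<le> C' * (exp (T * C') * M)" if "q \<in> {0..T}" for q y
      unfolding abs_minus_cancel by (rule L'.L_abs_le[OF g_le[OF that]])
    from op_exp_has_derivative[where g="?g" and g'="\<lambda>s y. - L' (?g s) y" and x=x,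
        OF r L'.op_exp_flip_has_derivative[OF f] g_le this]
    have "((\<lambda>s. op_exp L s (?g s) x) has_real_derivative op_exp L r (\<lambda>y. - c * ?g r y) x)
        (at r within {0..T})"
      by (simp add: shift)
    then have *: "((\<lambda>s. op_exp L s (?g s) x) has_real_derivative - c * op_exp L r (?g r) x)
        (at r within {0..T})"
      unfolding op_exp_mult[OF g_le[OF r]] .
    have "((\<lambda>s. exp (c * s)) has_real_derivative c * exp (c * r)) (at r within {0..T})"
      by (auto intro!: derivative_eq_intros)
    from DERIV_mult[OF this *] show ?thesis by (simp add: mult_ac)
  qed
  then obtain k where "\<And>r. r \<in> {0..T} \<Longrightarrow> ?h r = k"
    using has_field_derivative_zero_constant[of "{0..T}" ?h] by auto
  from this[OF s] this[of 0] s show ?thesis by simp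
qed

lemma op_exp_semigroup:
  assumes "\<And>y. \<bar>f y\<bar> \<le> M" and "s \<in> {0..T}"
  shows "op_exp L s (op_exp L (T - s) f) x = op_exp L T f x"
proof -
  have "L h y = L h y + 0 * h y" for h y by simp
  from op_exp_shift[OF finite_row_operator_axioms this assms] show ?thesis by simp
qed

end

section \<open>The heat semigroup of a weighted graph\<close>

context weighted_graph
begin

abbreviation lap :: "('v \<Rightarrow> real) \<Rightarrow> 'v \<Rightarrow> real" where
  "lap \<equiv> laplacian w \<mu>"

abbreviation \<Gamma> :: "('v \<Rightarrow> real) \<Rightarrow> ('v \<Rightarrow> real) \<Rightarrow> 'v \<Rightarrow> real" where
  "\<Gamma> \<equiv> Gamma_form w \<mu>"

text \<open>The constant \<open>D\<^sub>\<mu>\<close> of the standing assumptions.\<close>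

definition max_deg :: real where
  "max_deg = (SUP x. vdeg w x / \<mu> x)"

lemma vdeg_le: "vdeg w x \<le> max_deg * \<mu> x"
  using cSUP_upper[OF _ degree_bounded, of x] measure_pos[of x]
  by (simp add: max_deg_def divide_simps mult_ac)

lemma vdeg_nonneg: "0 \<le> vdeg w x"
  unfolding vdeg_def by (intro sum_nonneg weight_nonneg)

lemma max_deg_nonneg: "0 \<le> max_deg"
proof -
  fix x :: 'v
  have "0 \<le> max_deg * \<mu> x"
    by (rule order_trans[OF vdeg_nonneg vdeg_le])
  then show ?thesis
    using measure_pos[of x] by (simp add: zero_le_mult_iff)
qed

text \<open>The matrix row of the Laplacian has a diagonal place even at a vertex without loop;
  adding \<open>x\<close> to its neighbours then costs nothing, since \<open>w x x\<close> is zero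
  there.\<close>

lemma sum_insert_nbrs: "(\<Sum>y\<in>insert x (nbrs w x). w x y * f y) = (\<Sum>y\<in>nbrs w x. w x y * f y)"
proof -
  have "w x x = 0" if "x \<notin> nbrs w x"
    using that weight_nonneg[of x x] by (auto simp: nbrs_def)
  then show ?thesis
    by (cases "x \<in> nbrs w x") (auto simp: insert_absorb locally_finite)
qed

lemma shifted_lap_eq:
  "lap f x + c * f x
    = (\<Sum>y\<in>insert x (nbrs w x). (w x y + (if y = x then c * \<mu> x - vdeg w x else 0)) / \<mu> x * f y)"
proof -
  let ?N = "insert x (nbrs w x)"
  have "(\<Sum>y\<in>?N. (w x y + (if y = x then c * \<mu> x - vdeg w x else 0)) / \<mu> x * f y)
      = (\<Sum>y\<in>?N. w x y * f y / \<mu> x + (if y = x then (c * \<mu> x - vdeg w x) * f x / \<mu> x else 0))"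
    by (intro sum.cong refl) (auto simp: add_divide_distrib distrib_right)
  also have "\<dots> = (\<Sum>y\<in>?N. w x y * f y) / \<mu> x + (c * \<mu> x - vdeg w x) * f x / \<mu> x"
    using locally_finite by (simp add: sum.distrib sum_divide_distrib)
  also have "\<dots> = lap f x + c * f x"
  proof -
    have "lap f x = ((\<Sum>y\<in>nbrs w x. w x y * f y) - vdeg w x * f x) / \<mu> x"
      by (simp add: laplacian_def vdeg_def right_diff_distrib sum_subtractf sum_distrib_right diff_divide_distrib)
    moreover have "(c * \<mu> x - vdeg w x) * f x / \<mu> x = c * f x - vdeg w x * f x / \<mu> x"
      using measure_pos[of x] by (simp add: field_simps)
    ultimately show ?thesis
      unfolding sum_insert_nbrs by (simp add: diff_divide_distrib)
  qed
  finally show ?thesis by simp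
qed

lemma sum_row_abs:
  "(\<Sum>y\<in>insert x (nbrs w x). \<bar>(w x y + (if y = x then d else 0)) / \<mu> x\<bar>) \<le> (vdeg w x + \<bar>d\<bar>) / \<mu> x"
proof -
  have "(\<Sum>y\<in>insert x (nbrs w x). \<bar>(w x y + (if y = x then d else 0)) / \<mu> x\<bar>)
      \<le> (\<Sum>y\<in>insert x (nbrs w x). (w x y + (if y = x then \<bar>d\<bar> else 0)) / \<mu> x)"
    using measure_pos[of x] by (intro sum_mono) (auto simp: weight_nonneg divide_simps abs_if)
  also have "\<dots> = (vdeg w x + \<bar>d\<bar>) / \<mu> x"
    using sum_insert_nbrs[of x "\<lambda>_. 1"] locally_finite
    by (simp add: sum_divide_distrib[symmetric] sum.distrib vdeg_def)
  finally show ?thesis .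
qed

text \<open>The shift \<open>c\<close> covers two uses: \<open>c = 0\<close> is the Laplacian
  itself, and \<open>c = max_deg\<close> makes all matrix entries nonnegative.\<close>

lemma finite_row_shifted_lap:
  "finite_row_operator (\<lambda>f x. lap f x + c * f x) (\<lambda>x. insert x (nbrs w x))
    (\<lambda>x y. (w x y + (if y = x then c * \<mu> x - vdeg w x else 0)) / \<mu> x) (2 * max_deg + \<bar>c\<bar>)"
proof (unfold_locales, rule shifted_lap_eq)
  show "(\<Sum>y\<in>insert x (nbrs w x). \<bar>(w x y + (if y = x then c * \<mu> x - vdeg w x else 0)) / \<mu> x\<bar>)
      \<le> 2 * max_deg + \<bar>c\<bar>" for x
  proof (rule order_trans[OF sum_row_abs])
    have "\<bar>c * \<mu> x - vdeg w x\<bar> \<le> \<bar>c\<bar> * \<mu> x + vdeg w x"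
      using vdeg_nonneg[of x] measure_pos[of x] abs_triangle_ineq4[of "c * \<mu> x" "vdeg w x"]
      by (simp add: abs_mult)
    then show "(vdeg w x + \<bar>c * \<mu> x - vdeg w x\<bar>) / \<mu> x \<le> 2 * max_deg + \<bar>c\<bar>"
      using vdeg_le[of x] measure_pos[of x] by (simp add: pos_divide_le_eq algebra_simps)
  qed
qed (use locally_finite in simp)

sublocale heat: finite_row_operator lap "\<lambda>x. insert x (nbrs w x)"
    "\<lambda>x y. (w x y + (if y = x then - vdeg w x else 0)) / \<mu> x" "2 * max_deg"
  using finite_row_shifted_lap[of 0] unfolding mult_zero_left diff_0 abs_zero add_0_right .

section \<open>Positivity and conservation of constants\<close>

abbreviation P :: "real \<Rightarrow> ('v \<Rightarrow> real) \<Rightarrow> 'v \<Rightarrow> real" where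
  "P \<equiv> op_exp lap"

text \<open>\<open>\<Delta> + max_deg\<close> has nonnegative matrix entries, so its exponential
  \<open>e\<^bsup>t max_deg\<^esup> P\<^sub>t\<close> is bounded below by the identity.\<close>

lemma P_lower_bound:
  assumes f: "\<And>y. \<bar>f y\<bar> \<le> M" and nonneg: "\<And>y. 0 \<le> f y" and t: "0 \<le> t"
  shows "exp (- max_deg * t) * f x \<le> P t f x"
proof -
  let ?A = "\<lambda>f x. lap f x + max_deg * f x"
  interpret A: finite_row_operator ?A "\<lambda>x. insert x (nbrs w x)"
    "\<lambda>x y. (w x y + (if y = x then max_deg * \<mu> x - vdeg w x else 0)) / \<mu> x" "2 * max_deg + \<bar>max_deg\<bar>"
    by (rule finite_row_shifted_lap)
  have A_nonneg: "0 \<le> ?A g x" if "\<And>y. 0 \<le> g y" for g x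
    unfolding shifted_lap_eq
    using that vdeg_le[of x] weight_nonneg measure_pos[of x]
    by (intro sum_nonneg mult_nonneg_nonneg) (auto intro!: divide_nonneg_pos add_nonneg_nonneg)
  have "0 \<le> (?A ^^ k) f x" for k x
  proof (induction k arbitrary: x)
    case (Suc k)
    show ?case
      unfolding funpow.simps o_apply by (rule A_nonneg) (rule Suc)
  qed (use nonneg in simp)
  \<comment> \<open>All terms of the series are nonnegative, so it dominates its term of index
    \<open>0\<close>.\<close>
  then have "(\<Sum>k\<in>{0}. t ^ k / fact k * (?A ^^ k) f x) \<le> op_exp ?A t f x"
    unfolding op_exp_def using A.op_exp_sums[OF f, where t=t and x=x] t
    by (intro sum_le_suminf) (auto simp: sums_iff)
  then have "f x \<le> exp (max_deg * t) * P t f x"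
    using heat.op_exp_shift[OF finite_row_shifted_lap[of max_deg] refl f, where s=t and T=t and x=x] t by simp
  then show ?thesis
    by (simp add: exp_minus divide_simps mult.commute)
qed

lemma lap_const [simp]: "lap (\<lambda>y. c) x = 0"
  by (simp add: laplacian_def)

text \<open>The Laplacian annihilates constants, so only the term of index \<open>0\<close>
  survives.\<close>

lemma P_const: "P t (\<lambda>y. c) x = c"
proof -
  have lap0: "lap (\<lambda>y. c) = (\<lambda>y. 0)" by (simp add: fun_eq_iff)
  have pow: "(lap ^^ k) (\<lambda>y. c) x = (if k = 0 then c else 0)" for k
    by (cases k) (simp_all add: funpow_Suc_right lap0 heat.pow_zero del: funpow.simps(2))
  show ?thesis
    unfolding op_exp_def pow using suminf_finite[of "{0}" "\<lambda>k. t ^ k / fact k * (if k = 0 then c else 0)"]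
    by simp
qed

text \<open>The lower bound for \<open>P\<close> is applied to the nonnegative function
  \<open>g - f\<close>.\<close>

lemma P_mono:
  assumes f: "\<And>y. \<bar>f y\<bar> \<le> M" and g: "\<And>y. \<bar>g y\<bar> \<le> M'" and "\<And>y. f y \<le> g y" and "0 \<le> t"
  shows "P t f x \<le> P t g x"
proof -
  have "\<bar>g y - f y\<bar> \<le> M + M'" for y
    using f[of y] g[of y] by linarith
  then have "exp (- max_deg * t) * (g x - f x) \<le> P t (\<lambda>y. g y - f y) x"
    by (rule P_lower_bound) (use assms in auto)
  moreover have "0 \<le> exp (- max_deg * t) * (g x - f x)"
    using assms(3)[of x] by simp
  moreover have "P t (\<lambda>y. 1 * g y + - 1 * f y) x = 1 * P t g x + - 1 * P t f x"
    by (rule heat.op_exp_lincomb[OF g f])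
  ultimately show ?thesis by simp
qed

section \<open>Agreement with the Dirichlet heat kernels\<close>

text \<open>Cutting off outside \<open>U\<close> cannot increase a uniform bound, so the estimate
  for the full Laplacian persists with a constant independent of \<open>U\<close>.\<close>

lemma dirichlet_pow_abs_le:
  assumes "\<And>y. \<bar>f y\<bar> \<le> M"
  shows "\<bar>(dirichlet_laplacian w \<mu> U ^^ k) f x\<bar> \<le> (2 * max_deg) ^ k * M"
proof (induction k arbitrary: x)
  case (Suc k)
  have M: "0 \<le> M" using assms[of x] by linarith
  let ?g = "\<lambda>y. if y \<in> U then (dirichlet_laplacian w \<mu> U ^^ k) f y else 0"
  have "\<bar>?g y\<bar> \<le> (2 * max_deg) ^ k * M" for y
    using Suc[of y] M max_deg_nonneg by simp
  from heat.L_abs_le[of ?g, OF this] have "\<bar>lap ?g x\<bar> \<le> (2 * max_deg) ^ Suc k * M"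
    by (simp add: mult_ac)
  moreover have "(dirichlet_laplacian w \<mu> U ^^ Suc k) f x = (if x \<in> U then lap ?g x else 0)"
    unfolding funpow.simps o_apply by (rule dirichlet_laplacian_def)
  ultimately show ?case
    using M max_deg_nonneg by simp
qed (use assms in simp)

text \<open>If \<open>U\<close> contains a large enough neighbourhood of \<open>x\<close>, the
  cutoff is not felt at \<open>x\<close> by \<open>k\<close> applications of the Laplacian.\<close>

lemma dirichlet_pow_eq:
  "\<exists>F. finite F \<and> (\<forall>U. F \<subseteq> U \<longrightarrow> (dirichlet_laplacian w \<mu> U ^^ k) f x = (lap ^^ k) f x)"
proof (induction k arbitrary: x)
  case 0
  show ?case by (rule exI[of _ "{}"]) simp
next
  case (Suc k)
  then obtain F where F: "\<And>x. finite (F x)"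
    "\<And>x U. F x \<subseteq> U \<Longrightarrow> (dirichlet_laplacian w \<mu> U ^^ k) f x = (lap ^^ k) f x"
    by metis
  let ?N = "insert x (nbrs w x)"
  show ?case
  proof (intro exI[of _ "?N \<union> (\<Union>y\<in>?N. F y)"] conjI allI impI)
    fix U assume U: "?N \<union> (\<Union>y\<in>?N. F y) \<subseteq> U"
    then have "y \<in> U \<and> (dirichlet_laplacian w \<mu> U ^^ k) f y = (lap ^^ k) f y" if "y \<in> ?N" for y
      using that by (auto intro!: F(2))
    then show "(dirichlet_laplacian w \<mu> U ^^ Suc k) f x = (lap ^^ Suc k) f x"
      unfolding funpow.simps o_apply dirichlet_laplacian_def[of _ _ _ "(_ ^^ k) f"]
        laplacian_def
      by auto
  qed (use F locally_finite in auto)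
qed

text \<open>The two preceding lemmas supply the hypotheses of \<open>heat.op_exp_tendsto\<close>
  along the filter of finite sets. From here on a power series replaces the limit of Dirichlet
  kernels.\<close>

lemma heat_kernel_eq: "heat_kernel w \<mu> t x y = P t (\<lambda>z. if z = y then 1 / \<mu> y else 0) x"
  unfolding heat_kernel_def
proof (rule tendsto_Lim)
  let ?d = "\<lambda>z. if z = y then 1 / \<mu> y else 0"
  have d: "\<bar>?d z\<bar> \<le> 1 / \<mu> y" for z
    using measure_pos[of y] by simp
  have "((\<lambda>U. \<Sum>k. t ^ k / fact k * (dirichlet_laplacian w \<mu> U ^^ k) ?d x) \<longlongrightarrow> P t ?d x)
      (finite_subsets_at_top UNIV)"
  proof (rule heat.op_exp_tendsto[OF _ d])
    show "\<forall>\<^sub>F U in finite_subsets_at_top UNIV.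
        (dirichlet_laplacian w \<mu> U ^^ k) ?d x = (lap ^^ k) ?d x" for k
      using dirichlet_pow_eq[of k ?d x]
      unfolding eventually_finite_subsets_at_top by blast
  qed (use dirichlet_pow_abs_le[OF d] in auto)
  then show "((\<lambda>U. dirichlet_heat_kernel w \<mu> U t x y) \<longlongrightarrow> P t ?d x)
      (finite_subsets_at_top UNIV)"
  proof (rule Lim_transform_eventually)
    show "\<forall>\<^sub>F U in finite_subsets_at_top UNIV.
        (\<Sum>k. t ^ k / fact k * (dirichlet_laplacian w \<mu> U ^^ k) ?d x)
          = dirichlet_heat_kernel w \<mu> U t x y"
      unfolding eventually_finite_subsets_at_top dirichlet_heat_kernel_def
      by (intro exI[of _ "{x, y}"]) auto
  qed
qed simp

text \<open>The kernel starts from indicators divided by \<open>\<mu> y\<close>, so the weight in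
  the sum restores plain indicators, and \<open>heat.op_exp_has_sum\<close> superposes them.\<close>

lemma heat_semigroup_eq:
  assumes f: "\<And>y. \<bar>f y\<bar> \<le> M"
  shows "heat_semigroup w \<mu> t f = P t f"
proof
  fix x
  have "\<mu> y * heat_kernel w \<mu> t x y = P t (\<lambda>z. if z = y then 1 else 0) x" for y
  proof -
    have "\<mu> y * P t (\<lambda>z. if z = y then 1 / \<mu> y else 0) x
        = P t (\<lambda>z. \<mu> y * (if z = y then 1 / \<mu> y else 0)) x"
      using measure_pos[of y]
      by (intro heat.op_exp_mult[of _ "1 / \<mu> y", symmetric]) simp
    also have "(\<lambda>z. \<mu> y * (if z = y then 1 / \<mu> y else 0)) = (\<lambda>z. if z = y then 1 else 0)"
      using measure_pos[of y] by auto
    finally show ?thesis unfolding heat_kernel_eq .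
  qed
  then show "heat_semigroup w \<mu> t f x = P t f x"
    unfolding heat_semigroup_def
    using infsumI[OF heat.op_exp_has_sum[OF f, where t=t and x=x]] by (simp add: mult.commute)
qed

subsection \<open>Gamma calculus\<close>

text \<open>The product of differences is \<open>f y * g y - f x * g x\<close> less the two
  first-order terms. This form shows symmetry and bilinearity, and that a value of
  \<open>\<Gamma>\<close> depends on finitely many values of \<open>f\<close> and
  \<open>g\<close>.\<close>

lemma Gamma_sum:
  "\<Gamma> f g x = (1 / (2 * \<mu> x)) * (\<Sum>y\<in>nbrs w x. w x y * ((f y - f x) * (g y - g x)))"
proof -
  have "(\<Sum>y\<in>nbrs w x. w x y * ((f y - f x) * (g y - g x)))
      = (\<Sum>y\<in>nbrs w x. w x y * (f y * g y - f x * g x))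
        - f x * (\<Sum>y\<in>nbrs w x. w x y * (g y - g x)) - g x * (\<Sum>y\<in>nbrs w x. w x y * (f y - f x))"
    unfolding sum_distrib_left sum_subtractf[symmetric]
    by (intro sum.cong refl) (simp add: algebra_simps)
  moreover have "(1 / 2) * ((1 / m) * a - p * ((1 / m) * b) - q * ((1 / m) * c))
      = (1 / (2 * m)) * (a - p * b - q * c)" for a b c p q m :: real
    by (cases "m = 0") (simp_all add: field_simps)
  ultimately show ?thesis
    unfolding Gamma_form_def laplacian_def by metis
qed

lemma Gamma_commute: "\<Gamma> f g x = \<Gamma> g f x"
  unfolding Gamma_sum by (simp add: mult.commute)

lemma Gamma_lincomb: "\<Gamma> f (\<lambda>y. a * g y + b * h y) x = a * \<Gamma> f g x + b * \<Gamma> f h x"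
  unfolding Gamma_sum sum_distrib_left sum.distrib[symmetric]
  by (intro sum.cong refl) (simp add: algebra_simps)

text \<open>The constant \<open>3\<close> is half of \<open>2 + 2 + 2\<close>, one contribution for
  each of the three Laplacians in the definition of \<open>\<Gamma>\<close>.\<close>

lemma Gamma_abs_le:
  assumes f: "\<And>y. \<bar>f y\<bar> \<le> M" and g: "\<And>y. \<bar>g y\<bar> \<le> M'"
  shows "\<bar>\<Gamma> f g x\<bar> \<le> 3 * max_deg * (M * M')"
proof -
  have M: "0 \<le> M" "0 \<le> M'" using f[of x] g[of x] by linarith+
  have "\<bar>f y * g y\<bar> \<le> M * M'" for y
    unfolding abs_mult by (intro mult_mono f g M) auto
  from heat.L_abs_le[of "\<lambda>y. f y * g y", OF this]
  have 1: "\<bar>lap (\<lambda>y. f y * g y) x\<bar> \<le> 2 * max_deg * (M * M')" .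
  have 2: "\<bar>f x * lap g x\<bar> \<le> M * (2 * max_deg * M')"
    unfolding abs_mult by (intro mult_mono f M heat.L_abs_le[of g] g) auto
  have 3: "\<bar>g x * lap f x\<bar> \<le> M' * (2 * max_deg * M)"
    unfolding abs_mult by (intro mult_mono g M heat.L_abs_le[of f] f) auto
  have "\<bar>2 * \<Gamma> f g x\<bar> \<le> 2 * max_deg * (M * M') + M * (2 * max_deg * M') + M' * (2 * max_deg * M)"
  proof -
    have "2 * \<Gamma> f g x = lap (\<lambda>y. f y * g y) x - f x * lap g x - g x * lap f x"
      by (simp add: Gamma_form_def)
    with 1 2 3 show ?thesis by linarith
  qed
  then show ?thesis by (simp add: mult_ac)
qed

lemma Gamma_has_derivative:
  assumes u: "\<And>y. ((\<lambda>s. u s y) has_real_derivative u' y) (at t within S)"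
  shows "((\<lambda>s. \<Gamma> (u s) (u s) x) has_real_derivative 2 * \<Gamma> (u t) u' x) (at t within S)"
proof -
  have "((\<lambda>s. w x y * ((u s y - u s x) * (u s y - u s x))) has_real_derivative
      2 * (w x y * ((u t y - u t x) * (u' y - u' x)))) (at t within S)" for y
    by (rule derivative_eq_intros u refl)+ (simp add: algebra_simps)
  then have "((\<lambda>s. \<Sum>y\<in>nbrs w x. w x y * ((u s y - u s x) * (u s y - u s x))) has_real_derivative
      (\<Sum>y\<in>nbrs w x. 2 * (w x y * ((u t y - u t x) * (u' y - u' x))))) (at t within S)"
    by (rule DERIV_sum)
  from DERIV_cmult[OF this, of "1 / (2 * \<mu> x)"] show ?thesis
    unfolding Gamma_sum sum_distrib_left[symmetric] by (simp add: mult_ac)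
qed

text \<open>If \<open>u^2\<close> solves the backward heat equation, then
  \<open>- lap (u^2) / (2 u)\<close> is the time derivative of \<open>u\<close>, and the right-hand
  side is the time derivative of \<open>\<Gamma> u u\<close> plus its Laplacian. The identity rests
  on \<open>lap (u^2) = 2 u lap u + 2 \<Gamma> u u\<close>.\<close>

lemma two_Gamma2_tilde:
  assumes u: "\<And>y. u y > 0"
  shows "2 * Gamma2_tilde w \<mu> u x
    = lap (\<Gamma> u u) x + 2 * \<Gamma> u (\<lambda>y. - lap (\<lambda>z. u z * u z) y / (2 * u y)) x"
proof -
  have "- lap (\<lambda>z. u z * u z) y / (2 * u y) = - 1 * lap u y + - 1 * (\<Gamma> u u y / u y)" for y
    using u[of y] by (simp add: Gamma_form_def field_simps)
  then show ?thesis
    unfolding Gamma2_tilde_def Gamma2_form_def Gamma_commute[of "lap u" u]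
    by (simp only: Gamma_lincomb) (simp add: algebra_simps)
qed

text \<open>The inequality \<open>ln t \<le> t - 1\<close> at \<open>t = u y / u x\<close> gives
  \<open>u lap (ln u) \<le> lap u\<close>; the right-hand side of the claim equals
  \<open>u lap u\<close>.\<close>

lemma sq_mult_lap_ln_le:
  assumes u: "\<And>y. u y > 0"
  shows "(u x)\<^sup>2 * lap (\<lambda>y. ln (u y)) x \<le> lap (\<lambda>y. u y * u y) x / 2 - \<Gamma> u u x"
proof -
  have "u x * (ln (u y) - ln (u x)) \<le> u y - u x" for y
  proof -
    have "ln (u y) - ln (u x) \<le> u y / u x - 1"
      using ln_le_minus_one[of "u y / u x"] u by (simp add: ln_div less_imp_neq[THEN not_sym])
    then have "u x * (ln (u y) - ln (u x)) \<le> u x * (u y / u x - 1)"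
      using u[of x] by (intro mult_left_mono) auto
    also have "\<dots> = u y - u x"
      using u[of x] by (simp add: field_simps)
    finally show ?thesis .
  qed
  then have "(\<Sum>y\<in>nbrs w x. w x y * (u x * (ln (u y) - ln (u x)))) \<le> (\<Sum>y\<in>nbrs w x. w x y * (u y - u x))"
    by (intro sum_mono mult_left_mono weight_nonneg)
  then have "(\<Sum>y\<in>nbrs w x. w x y * (u x * (ln (u y) - ln (u x)))) / \<mu> x \<le> lap u x"
    using measure_pos[of x] by (simp add: laplacian_def divide_right_mono)
  moreover have "u x * lap (\<lambda>y. ln (u y)) x
      = (\<Sum>y\<in>nbrs w x. w x y * (u x * (ln (u y) - ln (u x)))) / \<mu> x"
    unfolding laplacian_def sum_distrib_left sum_divide_distrib
    by (intro sum.cong refl) (simp add: mult_ac)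
  ultimately have "u x * lap (\<lambda>y. ln (u y)) x \<le> lap u x" by simp
  then have "u x * (u x * lap (\<lambda>y. ln (u y)) x) \<le> u x * lap u x"
    using u[of x] by (intro mult_left_mono) auto
  then show ?thesis
    by (simp add: Gamma_form_def power2_eq_square diff_divide_distrib mult_ac)
qed

end

text \<open>Completing the square \<open>(c l - n d / 2)\<^sup>2 \<ge> 0\<close>; since \<open>c d \<le> 0\<close>, the term linear in
  \<open>l\<close> can be bounded below by an upper bound for \<open>U l\<close>.\<close>

lemma completed_square_bound:
  fixes n c d K :: real
  assumes n: "n > 0" and c: "c \<ge> 0" and d: "d \<le> 0" and U: "U \<ge> 0"
    and Z: "(2 / n) * (U * l\<^sup>2) + 2 * K * G \<le> Z" and l: "U * l \<le> L / 2 - G"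
  shows "c * d * L - (n / 2) * d\<^sup>2 * U \<le> 2 * c * (d - K * c) * G + c\<^sup>2 * Z"
proof -
  have "0 \<le> (2 / n) * U * (c * l - n * d / 2)\<^sup>2"
    using n U by simp
  also have "\<dots> = c\<^sup>2 * ((2 / n) * (U * l\<^sup>2)) - 2 * (c * d) * (U * l) + (n / 2) * d\<^sup>2 * U"
    using n by (simp add: power2_eq_square field_simps)
  finally have 1: "2 * (c * d) * (U * l) - (n / 2) * d\<^sup>2 * U \<le> c\<^sup>2 * ((2 / n) * (U * l\<^sup>2))" by simp
  have "c * d * (L / 2 - G) \<le> c * d * (U * l)"
    using l c d by (intro mult_left_mono_neg) (auto simp: mult_nonneg_nonpos)
  moreover have "c\<^sup>2 * ((2 / n) * (U * l\<^sup>2) + 2 * K * G) \<le> c\<^sup>2 * Z"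
    by (intro mult_left_mono Z) auto
  ultimately show ?thesis
    using 1 by (simp add: algebra_simps power2_eq_square)
qed

lemma abs_lincomb_le:
  fixes c d :: real
  assumes "\<bar>f\<bar> \<le> M" and "\<bar>g\<bar> \<le> M'"
  shows "\<bar>c * f + d * g\<bar> \<le> \<bar>c\<bar> * M + \<bar>d\<bar> * M'"
proof -
  have "\<bar>c * f + d * g\<bar> \<le> \<bar>c\<bar> * \<bar>f\<bar> + \<bar>d\<bar> * \<bar>g\<bar>"
    unfolding abs_mult[symmetric] by (rule abs_triangle_ineq)
  also have "\<dots> \<le> \<bar>c\<bar> * M + \<bar>d\<bar> * M'"
    using assms by (intro add_mono mult_left_mono) auto
  finally show ?thesis .
qed

section \<open>The Li--Yau inequality\<close>

context weighted_graph
begin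

text \<open>The lower bound \<open>e\<close> keeps the time derivative of the square root uniformly
  bounded, as the product rule for \<open>P s (g s)\<close> demands on an infinite vertex set.
  Continuity of \<open>W'\<close> makes its square integrable.\<close>

lemma li_yau_of_bounded_below:
  fixes n K T :: real and W W' :: "real \<Rightarrow> real"
  assumes n: "n > 0" and cde: "CDE' w \<mu> n K" and T: "T > 0"
    and W: "\<And>t. t \<in> {0..T} \<Longrightarrow> (W has_real_derivative W' t) (at t within {0..T})"
    and W'_cont: "continuous_on {0..T} W'"
    and W_nonneg: "\<And>t. t \<in> {0..T} \<Longrightarrow> W t \<ge> 0"
    and W0: "W 0 = 1" and WT: "W T = 0"
    and W'_le: "\<And>t. t \<in> {0..T} \<Longrightarrow> W' t \<le> - K * W t"
    and e: "e > 0" and h_ge: "\<And>y. e \<le> h y" and h_le: "\<And>y. h y \<le> M"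
  shows "\<Gamma> (\<lambda>y. sqrt (P T h y)) (\<lambda>y. sqrt (P T h y)) x
    \<le> (1 / 2) * (1 - 2 * K * integral {0..T} (\<lambda>s. (W s)\<^sup>2)) * lap (P T h) x
      + (n / 2) * (integral {0..T} (\<lambda>s. (W' s)\<^sup>2) + K\<^sup>2 * integral {0..T} (\<lambda>s. (W s)\<^sup>2) - K) * P T h x"
proof -
  have h_abs: "\<bar>h y\<bar> \<le> M" for y
    using h_ge[of y] h_le[of y] e by auto
  have M: "0 \<le> M" using h_abs[of x] by linarith
  \<comment> \<open>\<open>q\<close> runs backwards in time, \<open>u'\<close> will be the time
    derivative of \<open>u\<close>, and \<open>Z\<close> is the time derivative of \<open>g\<close>
    plus its Laplacian.\<close>
  define q where "q s = P (T - s) h" for s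
  define u where "u s y = sqrt (q s y)" for s y
  define u' where "u' s y = - lap (q s) y / (2 * u s y)" for s y
  define g where "g s = \<Gamma> (u s) (u s)" for s
  define Z where "Z s y = lap (g s) y + 2 * \<Gamma> (u s) (u' s) y" for s y
  define \<phi> where "\<phi> s = P s (g s) x" for s
  define A where "A = lap (P T h) x"
  define B where "B = P T h x"

  \<comment> \<open>Constants are fixed by \<open>P\<close> and \<open>P\<close> is monotone, so
    both bounds on \<open>h\<close> pass to \<open>q\<close>.\<close>
  have q_ge: "e \<le> q s y" if "s \<in> {0..T}" for s y
    using P_mono[of "\<lambda>y. e" "\<bar>e\<bar>" h M "T - s" y] that h_abs h_ge by (simp add: q_def P_const)
  have q_le: "q s y \<le> M" if "s \<in> {0..T}" for s y
    using P_mono[of h M "\<lambda>y. M" M "T - s" y] that h_abs h_le M by (simp add: q_def P_const)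
  have q_abs: "\<bar>q s y\<bar> \<le> M" if "s \<in> {0..T}" for s y
    using q_ge[OF that, of y] q_le[OF that, of y] e by simp
  have lap_q: "\<bar>lap (q s) y\<bar> \<le> 2 * max_deg * M" if "s \<in> {0..T}" for s y
    by (rule heat.L_abs_le) (rule q_abs[OF that])
  have u_pos: "0 < u s y" if "s \<in> {0..T}" for s y
    using q_ge[OF that, of y] e by (simp add: u_def)
  have u_sq: "u s y * u s y = q s y" if "s \<in> {0..T}" for s y
    using q_ge[OF that, of y] e by (simp add: u_def)
  have u_abs: "\<bar>u s y\<bar> \<le> sqrt M" if "s \<in> {0..T}" for s y
    using u_pos[OF that, of y] q_le[OF that, of y] by (simp add: u_def)
  have u'_abs: "\<bar>u' s y\<bar> \<le> 2 * max_deg * M / (2 * sqrt e)" if s: "s \<in> {0..T}" for s y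
  proof -
    have "sqrt e \<le> u s y"
      using q_ge[OF s, of y] by (simp add: u_def)
    then show ?thesis
      unfolding u'_def abs_divide abs_minus_cancel
      using e M max_deg_nonneg by (intro frac_le lap_q[OF s]) auto
  qed
  have u_deriv: "((\<lambda>s. u s y) has_real_derivative u' s y) (at s within {0..T})"
    if s: "s \<in> {0..T}" for s y
  proof -
    have "((\<lambda>s. q s y) has_real_derivative - lap (q s) y) (at s within {0..T})"
      unfolding q_def by (rule heat.op_exp_flip_has_derivative[OF h_abs])
    moreover have "0 < q s y" using q_ge[OF s, of y] e by linarith
    ultimately have *: "((\<lambda>s. sqrt (q s y)) has_real_derivative inverse (sqrt (q s y)) / 2 * - lap (q s) y)
        (at s within {0..T})"
      by (rule DERIV_chain2[OF DERIV_real_sqrt, rotated])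
    have "inverse (sqrt (q s y)) / 2 * - lap (q s) y = u' s y"
      by (simp add: u_def u'_def field_simps)
    with * show ?thesis
      unfolding u_def by simp
  qed

  define Mg where "Mg = 3 * max_deg * (sqrt M * sqrt M)"
  define M1 where "M1 = 3 * max_deg * (sqrt M * (2 * max_deg * M / (2 * sqrt e)))"
  have g_abs: "\<bar>g s y\<bar> \<le> Mg" if "s \<in> {0..T}" for s y
    unfolding g_def Mg_def by (rule Gamma_abs_le; rule u_abs[OF that])
  have g'_abs: "\<bar>2 * \<Gamma> (u s) (u' s) y\<bar> \<le> 2 * M1" if "s \<in> {0..T}" for s y
  proof -
    have "\<bar>\<Gamma> (u s) (u' s) y\<bar> \<le> M1"
      unfolding M1_def by (rule Gamma_abs_le, rule u_abs[OF that], rule u'_abs[OF that])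
    then show ?thesis by linarith
  qed
  have Z_abs: "\<bar>Z s y\<bar> \<le> 2 * max_deg * Mg + 2 * M1" if "s \<in> {0..T}" for s y
    unfolding Z_def
    by (rule order_trans[OF abs_triangle_ineq add_mono[OF heat.L_abs_le[OF g_abs[OF that]] g'_abs[OF that]]])
  have \<phi>_deriv: "(\<phi> has_real_derivative P s (Z s) x) (at s within {0..T})" if s: "s \<in> {0..T}" for s
    unfolding \<phi>_def Z_def
    by (rule heat.op_exp_has_derivative[OF s _ g_abs g'_abs])
      (unfold g_def, rule Gamma_has_derivative[OF u_deriv])

  \<comment> \<open>\<open>?H'\<close> is the derivative of \<open>(W s)\<^sup>2 * \<phi> s\<close>;
    \<open>?r\<close> is its lower bound, in which only scalar functions of \<open>s\<close>
    multiply the fixed numbers \<open>A\<close> and \<open>B\<close>.\<close>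
  let ?d = "\<lambda>s. W' s + K * W s"
  let ?H' = "\<lambda>s. 2 * W s * W' s * \<phi> s + (W s)\<^sup>2 * P s (Z s) x"
  let ?r = "\<lambda>s. W s * ?d s * A + - ((n / 2) * (?d s)\<^sup>2) * B"

  have pointwise: "W s * ?d s * lap (q s) y + - ((n / 2) * (?d s)\<^sup>2) * q s y
      \<le> 2 * W s * W' s * g s y + (W s)\<^sup>2 * Z s y" if s: "s \<in> {0..T}" for s y
  proof -
    have sq: "(\<lambda>z. u s z * u s z) = q s"
      using u_sq[OF s] by auto
    have Z_eq: "Z s y = 2 * Gamma2_tilde w \<mu> (u s) y"
      unfolding two_Gamma2_tilde[of "u s", OF u_pos[OF s]] sq Z_def g_def u'_def ..
    have "(1 / n) * (u s y)\<^sup>2 * (lap (\<lambda>y. ln (u s y)) y)\<^sup>2 + K * g s y \<le> Gamma2_tilde w \<mu> (u s) y"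
      using cde u_pos[OF s] unfolding CDE'_def g_def by blast
    then have c1: "(2 / n) * ((u s y)\<^sup>2 * (lap (\<lambda>y. ln (u s y)) y)\<^sup>2) + 2 * K * g s y \<le> Z s y"
      unfolding Z_eq by simp
    have c2: "(u s y)\<^sup>2 * lap (\<lambda>y. ln (u s y)) y \<le> lap (q s) y / 2 - g s y"
      using sq_mult_lap_ln_le[of "u s" y, OF u_pos[OF s]] unfolding sq g_def .
    have d: "?d s \<le> 0"
      using W'_le[OF s] by simp
    \<comment> \<open>Here \<open>c = W s\<close>, \<open>U = u^2\<close> and \<open>l\<close> is
      the Laplacian of \<open>ln u\<close>; since \<open>?d s - K * W s = W' s\<close>, applying
      \<open>P s\<close> to the right-hand side will give \<open>?H'\<close>.\<close>
    have "W s * ?d s * lap (q s) y - (n / 2) * (?d s)\<^sup>2 * (u s y)\<^sup>2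
        \<le> 2 * W s * (?d s - K * W s) * g s y + (W s)\<^sup>2 * Z s y"
      by (rule completed_square_bound[OF n W_nonneg[OF s] d zero_le_power2 c1 c2])
    then show ?thesis
      using u_sq[OF s, of y] by (simp add: power2_eq_square)
  qed

  have r_le: "?r s \<le> ?H' s" if s: "s \<in> {0..T}" for s
  proof -
    \<comment> \<open>The semigroup law makes \<open>P s (q s)\<close> independent of
      \<open>s\<close>, so \<open>A\<close> and \<open>B\<close> are constants of the
      integration.\<close>
    have Pq: "P s (q s) = P T h"
      unfolding q_def by (rule ext, rule heat.op_exp_semigroup[OF h_abs s])
    have "?r s = W s * ?d s * P s (lap (q s)) x + - ((n / 2) * (?d s)\<^sup>2) * P s (q s) x"
      unfolding heat.op_exp_commute[OF q_abs[OF s]] Pq A_def B_def ..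
    also have "\<dots> = P s (\<lambda>y. W s * ?d s * lap (q s) y + - ((n / 2) * (?d s)\<^sup>2) * q s y) x"
      by (rule heat.op_exp_lincomb[OF lap_q[OF s] q_abs[OF s], symmetric])
    also have "\<dots> \<le> P s (\<lambda>y. 2 * W s * W' s * g s y + (W s)\<^sup>2 * Z s y) x"
      using s by (intro P_mono[OF abs_lincomb_le[OF lap_q[OF s] q_abs[OF s]]
            abs_lincomb_le[OF g_abs[OF s] Z_abs[OF s]] pointwise[OF s]]) auto
    also have "\<dots> = ?H' s"
      unfolding \<phi>_def by (rule heat.op_exp_lincomb[OF g_abs[OF s] Z_abs[OF s]])
    finally show ?thesis .
  qed

  have "((\<lambda>s. (W s)\<^sup>2 * \<phi> s) has_real_derivative ?H' s) (at s within {0..T})" if s: "s \<in> {0..T}" for s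
    by (rule derivative_eq_intros W[OF s] \<phi>_deriv[OF s] refl)+ (simp add: power2_eq_square algebra_simps)
  then have "(?H' has_integral (W T)\<^sup>2 * \<phi> T - (W 0)\<^sup>2 * \<phi> 0) {0..T}"
    using T by (intro fundamental_theorem_of_calculus)
      (auto simp: has_real_derivative_iff_has_vector_derivative)
  \<comment> \<open>As \<open>W 0 = 1\<close> and \<open>W T = 0\<close>, only the boundary term at
    \<open>0\<close> remains.\<close>
  then have H'_int: "(?H' has_integral - \<phi> 0) {0..T}"
    by (simp add: W0 WT)

  have W_cont: "continuous_on {0..T} W"
    using W by (intro DERIV_continuous_on)
  let ?I = "integral {0..T} (\<lambda>s. (W s)\<^sup>2)" and ?I' = "integral {0..T} (\<lambda>s. (W' s)\<^sup>2)"
  have I: "((\<lambda>s. (W s)\<^sup>2) has_integral ?I) {0..T}" "((\<lambda>s. (W' s)\<^sup>2) has_integral ?I') {0..T}"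
    by (intro integrable_integral integrable_continuous_real continuous_intros W_cont W'_cont)+
  \<comment> \<open>The integral of \<open>W * W'\<close> is \<open>- 1 / 2\<close>, the source of
    the constant \<open>1\<close> in \<open>1 - 2 * K * ?I\<close> and of the summand
    \<open>- K\<close>.\<close>
  have "((\<lambda>s. (W s)\<^sup>2 / 2) has_real_derivative W s * W' s) (at s within {0..T})" if s: "s \<in> {0..T}" for s
    by (auto intro!: derivative_eq_intros W[OF s])
  then have "((\<lambda>s. W s * W' s) has_integral (W T)\<^sup>2 / 2 - (W 0)\<^sup>2 / 2) {0..T}"
    using T by (intro fundamental_theorem_of_calculus)
      (auto simp: has_real_derivative_iff_has_vector_derivative)
  then have WW': "((\<lambda>s. W s * W' s) has_integral - 1 / 2) {0..T}"
    by (simp add: W0 WT)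
  \<comment> \<open>This integrand is \<open>?r\<close>, expanded in the products
    \<open>W * W'\<close>, \<open>W^2\<close> and \<open>W'^2\<close>, whose integrals are
    known.\<close>
  have "((\<lambda>s. (A - n * K * B) * (W s * W' s) + (A * K - (n / 2) * B * K\<^sup>2) * (W s)\<^sup>2
        + - ((n / 2) * B) * (W' s)\<^sup>2) has_integral
      (A - n * K * B) * (- 1 / 2) + (A * K - (n / 2) * B * K\<^sup>2) * ?I + - ((n / 2) * B) * ?I') {0..T}"
    by (intro has_integral_add has_integral_mult_right WW' I)
  also have "(\<lambda>s. (A - n * K * B) * (W s * W' s) + (A * K - (n / 2) * B * K\<^sup>2) * (W s)\<^sup>2
        + - ((n / 2) * B) * (W' s)\<^sup>2) = ?r"
    by (simp add: fun_eq_iff power2_eq_square algebra_simps)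
  finally have "(A - n * K * B) * (- 1 / 2) + (A * K - (n / 2) * B * K\<^sup>2) * ?I + - ((n / 2) * B) * ?I'
      \<le> - \<phi> 0"
    by (rule has_integral_le[OF _ H'_int r_le])
  then have "\<phi> 0 \<le> (1 / 2) * (1 - 2 * K * ?I) * A + (n / 2) * (?I' + K\<^sup>2 * ?I - K) * B"
    by (simp add: algebra_simps)
  moreover have "\<phi> 0 = \<Gamma> (\<lambda>y. sqrt (P T h y)) (\<lambda>y. sqrt (P T h y)) x"
    by (simp add: \<phi>_def g_def u_def[abs_def] q_def)
  ultimately show ?thesis
    unfolding A_def B_def by simp
qed

end

section \<open>Conclusion for bounded positive functions\<close>

text \<open>Derivatives within a nondegenerate closed interval are unique, so \<open>F'\<close>
  agrees there with the witness \<open>D 1\<close>, which is continuous because it has a derivative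
  itself.\<close>

lemma smooth_derivative_continuous:
  assumes smooth: "smooth_on_interval a b F" and "a < b"
    and F: "\<And>t. t \<in> {a..b} \<Longrightarrow> (F has_real_derivative F' t) (at t within {a..b})"
  shows "continuous_on {a..b} F'"
proof -
  obtain D :: "nat \<Rightarrow> real \<Rightarrow> real" where D0: "\<And>t. t \<in> {a..b} \<Longrightarrow> D 0 t = F t"
    and D: "\<And>k t. t \<in> {a..b} \<Longrightarrow> (D k has_real_derivative D (Suc k) t) (at t within {a..b})"
    using smooth unfolding smooth_on_interval_def by blast
  have "F' t = D 1 t" if t: "t \<in> {a..b}" for t
  proof -
    have "(F has_real_derivative D (Suc 0) t) (at t within {a..b})"
      by (rule has_field_derivative_transform_within[OF D[OF t] zero_less_one t]) (simp add: D0)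
    then show ?thesis
      using vector_derivative_unique_within_closed_interval[of a b t F "F' t" "D 1 t"] F[OF t] t \<open>a < b\<close>
      by (simp add: has_real_derivative_iff_has_vector_derivative)
  qed
  moreover have "continuous_on {a..b} (D 1)"
    using D by (intro DERIV_continuous_on)
  ultimately show ?thesis
    using continuous_on_cong[OF refl, of "{a..b}" F' "D 1"] by blast
qed

theorem theorem3p3:
  fixes w :: "'v \<Rightarrow> 'v \<Rightarrow> real" and \<mu> :: "'v \<Rightarrow> real"
    and n K T :: real and W W' :: "real \<Rightarrow> real" and f :: "'v \<Rightarrow> real" and x :: 'v
  assumes "weighted_graph w \<mu>"
    and "n > 0"
    and "CDE' w \<mu> n K"
    and "T > 0"
    and "smooth_on_interval 0 T W"
    and "\<And>t. t \<in> {0..T} \<Longrightarrow> (W has_real_derivative W' t) (at t within {0..T})"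
    and "\<And>t. t \<in> {0..T} \<Longrightarrow> W t \<ge> 0"
    and "W 0 = 1" and "W T = 0"
    and "\<And>t. t \<in> {0..T} \<Longrightarrow> W' t \<le> - K * W t"
    and "bounded (range f)"
    and "\<And>y. f y > 0"
  shows "Gamma_form w \<mu> (\<lambda>y. sqrt (heat_semigroup w \<mu> T f y)) (\<lambda>y. sqrt (heat_semigroup w \<mu> T f y)) x
           / heat_semigroup w \<mu> T f x
         \<le> (1 / 2) * (1 - 2 * K * integral {0..T} (\<lambda>s. (W s)\<^sup>2))
             * (laplacian w \<mu> (heat_semigroup w \<mu> T f) x / heat_semigroup w \<mu> T f x)
           + (n / 2) * (integral {0..T} (\<lambda>s. (W' s)\<^sup>2)
               + K\<^sup>2 * integral {0..T} (\<lambda>s. (W s)\<^sup>2) - K)"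
proof -
  interpret weighted_graph w \<mu> by fact
  obtain M where f_abs: "\<And>y. \<bar>f y\<bar> \<le> M"
    using \<open>bounded (range f)\<close> by (auto simp: bounded_iff)
  let ?q = "P T f"
  let ?c = "(1 / 2) * (1 - 2 * K * integral {0..T} (\<lambda>s. (W s)\<^sup>2))"
  let ?c' = "(n / 2) * (integral {0..T} (\<lambda>s. (W' s)\<^sup>2) + K\<^sup>2 * integral {0..T} (\<lambda>s. (W s)\<^sup>2) - K)"
  let ?G = "\<lambda>e. \<Gamma> (\<lambda>y. sqrt (?q y + e)) (\<lambda>y. sqrt (?q y + e)) x"
  \<comment> \<open>Strict positivity at \<open>x\<close>, which makes the final division
    legitimate.\<close>
  have "0 < exp (- max_deg * T) * f x"
    using assms(12) by simp
  also have "\<dots> \<le> ?q x"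
    by (rule P_lower_bound[OF f_abs]) (use assms(4,12) in \<open>auto intro: less_imp_le\<close>)
  finally have q_pos: "0 < ?q x" .
  have G_le: "?G e \<le> ?c * lap ?q x + ?c' * (?q x + e)" if "0 < e" for e
  proof -
    \<comment> \<open>Constants pass through \<open>P\<close> unchanged, so replacing
      \<open>f\<close> by \<open>f + e\<close> adds \<open>e\<close> to \<open>?q\<close>, which the
      Laplacian does not see.\<close>
    have "P T (\<lambda>y. f y + e) y = ?q y + e" for y
      using heat.op_exp_add[OF f_abs, where g="\<lambda>y. e" and M'="\<bar>e\<bar>"] by (simp add: P_const)
    then have q_eq: "P T (\<lambda>y. f y + e) = (\<lambda>y. ?q y + e)" ..
    have "f y + e \<le> M + e" and "e \<le> f y + e" for y
      using f_abs[of y] assms(12)[of y] by auto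
    from li_yau_of_bounded_below[where h="\<lambda>y. f y + e" and x=x, OF assms(2-4,6) smooth_derivative_continuous[OF assms(5,4,6)]
        assms(7-10) that this(2,1)]
    have "?G e \<le> ?c * lap (\<lambda>y. ?q y + e) x + ?c' * (?q x + e)"
      unfolding q_eq by simp
    also have "lap (\<lambda>y. ?q y + e) x = lap ?q x"
      by (simp add: laplacian_def)
    finally show ?thesis .
  qed
  \<comment> \<open>\<open>?G e\<close> is a finite sum over the neighbours of \<open>x\<close>,
    hence continuous in \<open>e\<close> up to \<open>0\<close>.\<close>
  have "(?G \<longlongrightarrow> ?G 0) (at_right 0)"
    unfolding Gamma_sum by (intro tendsto_intros)
  moreover have "((\<lambda>e. ?c * lap ?q x + ?c' * (?q x + e)) \<longlongrightarrow> ?c * lap ?q x + ?c' * (?q x + 0)) (at_right 0)"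
    by (intro tendsto_intros)
  moreover have "\<forall>\<^sub>F e in at_right 0. ?G e \<le> ?c * lap ?q x + ?c' * (?q x + e)"
    using G_le by (auto simp: eventually_at_right_less intro: eventually_mono[OF eventually_at_right_less])
  ultimately have "?G 0 \<le> ?c * lap ?q x + ?c' * (?q x + 0)"
    by (intro tendsto_le[OF trivial_limit_at_right_real])
  then have "?G 0 / ?q x \<le> (?c * lap ?q x + ?c' * ?q x) / ?q x"
    using q_pos by (intro divide_right_mono) auto
  also have "\<dots> = ?c * (lap ?q x / ?q x) + ?c' * (?q x / ?q x)"
    by (simp only: add_divide_distrib times_divide_eq_right)
  also have "?q x / ?q x = 1"
    using q_pos by simp
  finally show ?thesis
    unfolding heat_semigroup_eq[OF f_abs] by simp
qed

end
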